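(* Let $G$ be a graph and let $\mathcal{H}=\{H_j\}_{j\in J}$ be a finite family of connected nonnull subgraphs of $G$. Then $\mathsf{tree}\text{-}\alpha(G(\mathcal{H}))\le \mathsf{tree}\text{-}\alpha(G)$.
   Context: All graphs are finite, simple, and undirected; a graph is nonnull if it has at least one vertex. For a graph $G$ and a family $\mathcal{H}=\{H_j\}_{j\in J}$ of connected subgraphs of $G$, the graph $G(\mathcal{H})$ has vertex set $J$, and two distinct elements $i,j\in J$ are adjacent if and only if $H_i$ and $H_j$ have a vertex in common or there is an edge of $G$ with one endpoint in $H_i$ and the other in $H_j$. A tree decomposition of a graph $G$ is a pair $\mathcal{T}=(T,\{X_t\}_{t\in V(T)})$ where $T$ is a tree and each node $t$ is assigned a bag $X_t\subseteq V(G)$ such that every vertex of $G$ is in at least one bag, every edge of $G$ has both endpoints in some common bag, and for every $u\in V(G)$ the subgraph of $T$ induced by $\{t: u\in X_t\}$ is connected. The independence number of $\mathcal{T}$ is $\alpha(\mathcal{T})=\max_{t\in V(T)}\alpha(G[X_t])$, where $\alpha(H)$ is the maximum size of an independent set in $H$. The tree-independence number $\mathsf{tree}\text{-}\alpha(G)$ is the minimum of $\alpha(\mathcal{T})$ over all tree decompositions $\mathcal{T}$ of $G$. *)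

theory Defs
  imports "Graph_Theory.Graph_Theory"
begin

text \<open>
  Finite simple undirected graphs are represented by the locale \<^locale>\<open>graph\<close>: an undirected
  edge \<open>uv\<close> is a pair of opposite arcs \<open>u \<rightarrow> v\<close> and \<open>v \<rightarrow> u\<close>.
  Note that \<^const>\<open>Digraph_Component.connected\<close> requires at least one vertex.

  The graph \<open>touching_graph G J H\<close> is \<open>G(\<H>)\<close> for the family \<open>\<H> = {H j | j \<in> J}\<close> indexed by \<open>J\<close>.
\<close>

definition touching_graph ::
  "('a, 'b) pre_digraph \<Rightarrow> 'i set \<Rightarrow> ('i \<Rightarrow> ('a, 'b) pre_digraph) \<Rightarrow> 'i pair_pre_digraph" where
  "touching_graph G J H =
    \<lparr> pverts = J,
      parcs = {(i, j). i \<in> J \<and> j \<in> J \<and> i \<noteq> j \<and>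
        (verts (H i) \<inter> verts (H j) \<noteq> {} \<or>
         (\<exists>u \<in> verts (H i). \<exists>v \<in> verts (H j). u \<rightarrow>\<^bsub>G\<^esub> v))} \<rparr>"

text \<open>
  The constants \<^const>\<open>forest\<close> and \<^const>\<open>Digraph_Component.tree\<close> are unsuitable for undirected
  graphs in this representation: the closed walk \<open>u, v, u\<close> along a single edge is a
  \<^const>\<open>pre_digraph.cycle\<close>. Cycles of an undirected simple graph have length at least 3.
\<close>

definition undirected_tree :: "('t, 'e) pre_digraph \<Rightarrow> bool" where
  "undirected_tree T \<longleftrightarrow>
    graph T \<and> Digraph_Component.connected T \<and>
    \<not> (\<exists>p. pre_digraph.cycle T p \<and> 3 \<le> length p)"

definition tree_decomposition ::
  "('a, 'b) pre_digraph \<Rightarrow> ('t, 'e) pre_digraph \<Rightarrow> ('t \<Rightarrow> 'a set) \<Rightarrow> bool" where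
  "tree_decomposition G T X \<longleftrightarrow>
    undirected_tree T \<and>
    (\<forall>t \<in> verts T. X t \<subseteq> verts G) \<and>
    (\<forall>u \<in> verts G. \<exists>t \<in> verts T. u \<in> X t) \<and>
    (\<forall>u v. u \<rightarrow>\<^bsub>G\<^esub> v \<longrightarrow> (\<exists>t \<in> verts T. u \<in> X t \<and> v \<in> X t)) \<and>
    (\<forall>u \<in> verts G. Digraph_Component.connected (T \<restriction> {t \<in> verts T. u \<in> X t}))"

definition independent_set :: "('a, 'b) pre_digraph \<Rightarrow> 'a set \<Rightarrow> bool" where
  "independent_set G I \<longleftrightarrow> I \<subseteq> verts G \<and> (\<forall>u \<in> I. \<forall>v \<in> I. \<not> u \<rightarrow>\<^bsub>G\<^esub> v)"

definition independence_number :: "('a, 'b) pre_digraph \<Rightarrow> nat" where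
  "independence_number G = Max (card ` {I. independent_set G I})"

definition decomposition_alpha ::
  "('a, 'b) pre_digraph \<Rightarrow> ('t, 'e) pre_digraph \<Rightarrow> ('t \<Rightarrow> 'a set) \<Rightarrow> nat" where
  "decomposition_alpha G T X = Max ((\<lambda>t. independence_number (G \<restriction> X t)) ` verts T)"

text \<open>
  Since the trees are finite, it is no restriction to take natural numbers as their nodes.
  The infimum is a minimum, see \<open>tree_alpha_attained\<close> below.
\<close>

definition tree_alpha :: "('a, 'b) pre_digraph \<Rightarrow> nat" where
  "tree_alpha G =
    Inf {decomposition_alpha G (with_proj T) X | (T :: nat pair_pre_digraph) X.
      tree_decomposition G (with_proj T) X}"

lemma graph_touching_graph:
  assumes "graph G" and "finite J"
  shows "graph (with_proj (touching_graph G J H))"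
proof -
  let ?K = "touching_graph G J H"
  have sym: "v \<rightarrow>\<^bsub>G\<^esub> u" if "u \<rightarrow>\<^bsub>G\<^esub> v" for u v
    using that assms(1) arcs_ends_symmetric graph.axioms(2) pseudo_graph.axioms(2)
      sym_digraph.sym_arcs by metis
  have "parcs ?K \<subseteq> J \<times> J" by (auto simp: touching_graph_def)
  then have fin: "finite (parcs ?K)"
    using assms(2) finite_subset by blast
  have "symmetric (with_proj ?K)"
    unfolding symmetric_def sym_def by (auto simp: touching_graph_def dest: sym)
  then have "pair_graph ?K"
    using fin assms(2) by unfold_locales (auto simp: touching_graph_def)
  then show ?thesis by (rule pair_graph.pair_graphD_graph)
qed

lemma ex_tree_decomposition:
  assumes "graph G"
  shows "\<exists>(T :: nat pair_pre_digraph) X. tree_decomposition G (with_proj T) X"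
proof -
  define T :: "nat pair_pre_digraph" where "T = \<lparr> pverts = {0}, parcs = {} \<rparr>"
  interpret G: graph G by fact
  have "pair_graph T"
    by unfold_locales (auto simp: T_def symmetric_def sym_def)
  then have T: "graph (with_proj T)" by (rule pair_graph.pair_graphD_graph)
  have conn: "Digraph_Component.connected K"
    if "verts K = {0}" for K :: "(nat, nat \<times> nat) pre_digraph"
    using that
    by (auto simp: Digraph_Component.connected_def strongly_connected_def mk_symmetric_def
        reachable_def intro: rtrancl_on_refl)
  have "undirected_tree (with_proj T)"
    unfolding undirected_tree_def
    using T conn[of "with_proj T"]
    by (auto simp: T_def pre_digraph.cycle_def pre_digraph.awalk_def)
  moreover have "Digraph_Component.connected
      (with_proj T \<restriction> {t \<in> verts (with_proj T). u \<in> verts G})" if "u \<in> verts G" for u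
    using that by (intro conn) (auto simp: T_def)
  ultimately have "tree_decomposition G (with_proj T) (\<lambda>_. verts G)"
    unfolding tree_decomposition_def
    by (auto simp: T_def dest: G.adj_in_verts)
  then show ?thesis by blast
qed

lemma tree_alpha_attained:
  assumes "graph G"
  shows "\<exists>(T :: nat pair_pre_digraph) X.
    tree_decomposition G (with_proj T) X \<and> decomposition_alpha G (with_proj T) X = tree_alpha G"
proof -
  let ?S = "{decomposition_alpha G (with_proj T) X | (T :: nat pair_pre_digraph) X.
      tree_decomposition G (with_proj T) X}"
  have "?S \<noteq> {}" using ex_tree_decomposition[OF assms] by blast
  then have "Inf ?S \<in> ?S" by (rule Inf_nat_def1)
  then show ?thesis unfolding tree_alpha_def by force
qed

end

theory Submission
  imports Defs
begin

text \<open>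
  Keep the tree of an optimal decomposition of \<open>G\<close> and let the new bag at \<open>t\<close> consist of all \<open>j\<close>
  for which \<open>H j\<close> meets the old bag \<open>X t\<close>. The nodes whose new bag contains \<open>j\<close> form the union of
  the subtrees of the vertices of \<open>H j\<close>, and subtrees of adjacent vertices intersect, so this union
  is connected. Choosing a vertex of \<open>H j\<close> in \<open>X t\<close> for each \<open>j\<close> in an independent subset of a new
  bag gives an independent subset of the old bag of the same size.
\<close>

text \<open>A walk in \<open>K\<close> can be followed in \<open>T\<close>: inside each
  \<open>S u\<close> any two nodes are linked, and along an edge of \<open>K\<close> one passes from
  one set to the next through a common node. In the application \<open>K\<close> is some
  \<open>H j\<close>, and \<open>S u\<close> holds the nodes whose bag contains
  \<open>u\<close>.\<close>

lemma connected_induce_subgraph_UN: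
  assumes K: "Digraph_Component.connected K"
    and S: "\<And>u. u \<in> verts K \<Longrightarrow> Digraph_Component.connected (T \<restriction> S u)"
    and adj: "\<And>u v. u \<rightarrow>\<^bsub>K\<^esub> v \<Longrightarrow> S u \<inter> S v \<noteq> {}"
  shows "Digraph_Component.connected (T \<restriction> (\<Union>u\<in>verts K. S u))"
proof -
  define U where "U = (\<Union>u\<in>verts K. S u)"
  \<comment> \<open>\<open>R\<close> is reachability inside \<open>U\<close> with arcs taken in both
    directions, the form in which \<open>connected_conv\<close> expresses connectedness.\<close>
  define R where "R = rtrancl_on U ((arcs_ends (T \<restriction> U))\<^sup>s)"
  have within: "(s, t) \<in> R" if "u \<in> verts K" "s \<in> S u" "t \<in> S u" for u s t
  proof -
    have "S u \<subseteq> U" using that by (auto simp: U_def)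
    then have "arcs_ends (T \<restriction> S u) \<subseteq> arcs_ends (T \<restriction> U)"
      by (auto simp: arcs_ends_def)
    then have "(arcs_ends (T \<restriction> S u))\<^sup>s \<subseteq> (arcs_ends (T \<restriction> U))\<^sup>s"
      unfolding symcl_def by blast
    moreover have "(s, t) \<in> rtrancl_on (S u) ((arcs_ends (T \<restriction> S u))\<^sup>s)"
      using S[OF that(1)] that(2,3) by (simp add: connected_conv)
    ultimately show ?thesis
      unfolding R_def using \<open>S u \<subseteq> U\<close> by (metis rtrancl_on_mono)
  qed
  \<comment> \<open>Induction along a walk from \<open>u\<close> to \<open>v\<close> in
    \<open>K\<close>. The claim covers all of \<open>S v\<close>, so that the induction hypothesis
    can be applied at whichever node \<open>S v\<close> shares with the next set.\<close>
  have between: "\<forall>t \<in> S v. (s, t) \<in> R"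
    if "(u, v) \<in> rtrancl_on (verts K) ((arcs_ends K)\<^sup>s)" "s \<in> S u" for u v s
    using that(1)
  proof (induction rule: rtrancl_on_induct)
    case base
    then show ?case using within that(2) by blast
  next
    case (step v w)
    then have "v \<rightarrow>\<^bsub>K\<^esub> w \<or> w \<rightarrow>\<^bsub>K\<^esub> v" by (auto simp: symcl_def)
    then have "S v \<inter> S w \<noteq> {}" using adj by blast
    then obtain r where r: "r \<in> S v" "r \<in> S w" by blast
    show ?case
    proof
      fix t assume "t \<in> S w"
      then have "(r, t) \<in> R" using within step r by blast
      moreover have "(s, r) \<in> R" using step r by blast
      ultimately show "(s, t) \<in> R"
        unfolding R_def by (rule rtrancl_on_trans[rotated])
    qed
  qed
  \<comment> \<open>Connectedness includes having a vertex, both for \<open>K\<close> and for each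
    \<open>S u\<close>, and this makes the union nonempty.\<close>
  obtain u where u: "u \<in> verts K" using K by (auto simp: connected_conv)
  then have "S u \<noteq> {}" using S by (auto simp: connected_conv)
  then have "U \<noteq> {}" using u by (auto simp: U_def)
  moreover have "(s, t) \<in> R" if "s \<in> U" "t \<in> U" for s t
    using that between K unfolding U_def connected_conv by blast
  ultimately show ?thesis
    unfolding U_def[symmetric] connected_conv by (simp add: R_def)
qed

lemma finite_independent_sets: "finite (verts G) \<Longrightarrow> finite {I. independent_set G I}"
  by (rule finite_subset[of _ "Pow (verts G)"]) (auto simp: independent_set_def)

lemma card_le_independence_number:
  assumes "finite (verts G)" "independent_set G I"
  shows "card I \<le> independence_number G"
  unfolding independence_number_def
  using assms finite_independent_sets by (intro Max_ge) auto

lemma independence_number_le: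
  assumes "finite (verts G)" "\<And>I. independent_set G I \<Longrightarrow> card I \<le> k"
  shows "independence_number G \<le> k"
proof -
  \<comment> \<open>The empty set ensures that \<open>Max\<close> is taken over a nonempty
    set.\<close>
  have "independent_set G {}" by (simp add: independent_set_def)
  then have "{I. independent_set G I} \<noteq> {}" by blast
  then show ?thesis
    unfolding independence_number_def
    using assms finite_independent_sets by (subst Max_le_iff) auto
qed

lemma induce_subgraph_dominates_iff:
  "u \<rightarrow>\<^bsub>G \<restriction> S\<^esub> v \<longleftrightarrow> u \<rightarrow>\<^bsub>G\<^esub> v \<and> u \<in> S \<and> v \<in> S"
  by (auto simp: arcs_ends_conv)

lemma touching_graph_dominates_iff:
  "i \<rightarrow>\<^bsub>with_proj (touching_graph G J H)\<^esub> j \<longleftrightarrow>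
    i \<in> J \<and> j \<in> J \<and> i \<noteq> j \<and>
    (verts (H i) \<inter> verts (H j) \<noteq> {} \<or> (\<exists>u \<in> verts (H i). \<exists>v \<in> verts (H j). u \<rightarrow>\<^bsub>G\<^esub> v))"
  by (auto simp: touching_graph_def)

lemma verts_touching_graph: "verts (with_proj (touching_graph G J H)) = J"
  by (simp add: touching_graph_def)

text \<open>Representatives in \<open>B\<close> of distinct members of an independent set are
  neither equal nor adjacent, since either would make the two subgraphs touch. Choosing them is
  therefore injective and has an independent image.\<close>

lemma independence_number_touching_graph_le:
  assumes "graph G" and "finite J" and "finite B"
  shows "independence_number
      (with_proj (touching_graph G J H) \<restriction> {j \<in> J. verts (H j) \<inter> B \<noteq> {}})
    \<le> independence_number (G \<restriction> B)"
proof (rule independence_number_le)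
  interpret graph G by fact
  show "finite (verts (with_proj (touching_graph G J H) \<restriction> {j \<in> J. verts (H j) \<inter> B \<noteq> {}}))"
    using assms by simp
  fix I
  assume "independent_set (with_proj (touching_graph G J H) \<restriction> {j \<in> J. verts (H j) \<inter> B \<noteq> {}}) I"
  then have I: "\<And>j. j \<in> I \<Longrightarrow> j \<in> J \<and> (\<exists>x. x \<in> verts (H j) \<inter> B)"
    and indep: "\<And>i j. i \<in> I \<Longrightarrow> j \<in> I \<Longrightarrow>
      \<not> i \<rightarrow>\<^bsub>with_proj (touching_graph G J H)\<^esub> j"
    unfolding independent_set_def induce_subgraph_dominates_iff induce_subgraph_verts by blast+
  from I obtain x where x: "\<And>j. j \<in> I \<Longrightarrow> x j \<in> verts (H j) \<inter> B" by metis
  \<comment> \<open>Either alternative makes \<open>H i\<close> and \<open>H j\<close> touch, with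
    \<open>x i\<close> and \<open>x j\<close> as witnesses, so independence leaves only
    \<open>i = j\<close>. Equality of representatives thus gives injectivity, while adjacency would
    give a loop at \<open>x i\<close>, which a simple graph excludes.\<close>
  have "i = j" if "i \<in> I" "j \<in> I" "x i = x j \<or> x i \<rightarrow>\<^bsub>G\<^esub> x j" for i j
    using that indep[OF that(1,2)] I x unfolding touching_graph_dominates_iff by fastforce
  moreover have "\<not> u \<rightarrow>\<^bsub>G\<^esub> u" for u using adj_not_same by blast
  ultimately have "inj_on x I" and "\<And>i j. i \<in> I \<Longrightarrow> j \<in> I \<Longrightarrow> \<not> x i \<rightarrow>\<^bsub>G\<^esub> x j"
    unfolding inj_on_def by metis+
  then have "independent_set (G \<restriction> B) (x ` I)"
    using x by (auto simp: independent_set_def induce_subgraph_dominates_iff)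
  then have "card (x ` I) \<le> independence_number (G \<restriction> B)"
    using assms(3) by (intro card_le_independence_number) auto
  then show "card I \<le> independence_number (G \<restriction> B)"
    using card_image[OF \<open>inj_on x I\<close>] by simp
qed

lemma tree_decomposition_touching_graph:
  assumes td: "tree_decomposition G T X"
    and sub: "\<And>j. j \<in> J \<Longrightarrow> subgraph (H j) G"
    and conn: "\<And>j. j \<in> J \<Longrightarrow> Digraph_Component.connected (H j)"
  shows "tree_decomposition (with_proj (touching_graph G J H)) T
    (\<lambda>t. {j \<in> J. verts (H j) \<inter> X t \<noteq> {}})"
proof -
  have tree: "undirected_tree T"
    and cover: "\<And>u. u \<in> verts G \<Longrightarrow> \<exists>t \<in> verts T. u \<in> X t"
    and edge: "\<And>u v. u \<rightarrow>\<^bsub>G\<^esub> v \<Longrightarrow> \<exists>t \<in> verts T. u \<in> X t \<and> v \<in> X t"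
    and subtree: "\<And>u. u \<in> verts G \<Longrightarrow>
      Digraph_Component.connected (T \<restriction> {t \<in> verts T. u \<in> X t})"
    using td unfolding tree_decomposition_def by blast+
  have vG: "u \<in> verts G" if "j \<in> J" "u \<in> verts (H j)" for j u
    using sub[OF that(1)] that(2) subgraph_imp_subverts by blast
  have "\<exists>t \<in> verts T. verts (H j) \<inter> X t \<noteq> {}" if j: "j \<in> J" for j
  proof -
    obtain u where "u \<in> verts (H j)" using conn[OF j] by (auto simp: connected_conv)
    then show ?thesis using cover[OF vG[OF j]] by blast
  qed
  moreover have "i \<in> J \<and> j \<in> J \<and>
      (\<exists>t \<in> verts T. verts (H i) \<inter> X t \<noteq> {} \<and> verts (H j) \<inter> X t \<noteq> {})"
    if ij: "i \<rightarrow>\<^bsub>with_proj (touching_graph G J H)\<^esub> j" for i j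
  proof -
    have "i \<in> J" "j \<in> J" using ij unfolding touching_graph_dominates_iff by blast+
    \<comment> \<open>If \<open>H i\<close> and \<open>H j\<close> share a vertex, take
      \<open>u = v\<close> and any bag covering it; otherwise take the ends of a joining edge and a
      bag containing both.\<close>
    obtain u v t where "u \<in> verts (H i)" "v \<in> verts (H j)" "t \<in> verts T" "u \<in> X t" "v \<in> X t"
      using ij cover[OF vG[OF \<open>i \<in> J\<close>]] edge unfolding touching_graph_dominates_iff by blast
    then show ?thesis using \<open>i \<in> J\<close> \<open>j \<in> J\<close> by blast
  qed
  moreover have "Digraph_Component.connected (T \<restriction> {t \<in> verts T. verts (H j) \<inter> X t \<noteq> {}})"
    if "j \<in> J" for j
  proof -
    \<comment> \<open>Edges of \<open>H j\<close> are edges of \<open>G\<close>, so their two ends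
      share a bag and the corresponding subtrees meet.\<close>
    have "Digraph_Component.connected (T \<restriction> (\<Union>u\<in>verts (H j). {t \<in> verts T. u \<in> X t}))"
    proof (rule connected_induce_subgraph_UN)
      fix u v assume "u \<rightarrow>\<^bsub>H j\<^esub> v"
      then have "u \<rightarrow>\<^bsub>G\<^esub> v" using pre_digraph.adj_mono sub[OF that] by metis
      then show "{t \<in> verts T. u \<in> X t} \<inter> {t \<in> verts T. v \<in> X t} \<noteq> {}"
        using edge by blast
    qed (use conn subtree vG that in auto)
    moreover have "(\<Union>u\<in>verts (H j). {t \<in> verts T. u \<in> X t}) =
        {t \<in> verts T. verts (H j) \<inter> X t \<noteq> {}}" by blast
    ultimately show ?thesis by simp
  qed
  ultimately show ?thesis
    using tree unfolding tree_decomposition_def verts_touching_graph by simp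
qed

theorem theorem6p2:
  fixes G :: "('a, 'b) pre_digraph"
    and J :: "'i set"
    and H :: "'i \<Rightarrow> ('a, 'b) pre_digraph"
  assumes "graph G"
    and "finite J"
    and "\<And>j. j \<in> J \<Longrightarrow> graph (H j)"
    and "\<And>j. j \<in> J \<Longrightarrow> subgraph (H j) G"
    and "\<And>j. j \<in> J \<Longrightarrow> Digraph_Component.connected (H j)"
    and "\<And>j. j \<in> J \<Longrightarrow> verts (H j) \<noteq> {}"
  shows "tree_alpha (with_proj (touching_graph G J H)) \<le> tree_alpha G"
proof -
  interpret graph G by fact
  let ?K = "with_proj (touching_graph G J H)"
  obtain T :: "nat pair_pre_digraph" and X
    where td: "tree_decomposition G (with_proj T) X"
      and opt: "decomposition_alpha G (with_proj T) X = tree_alpha G"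
    using tree_alpha_attained[OF assms(1)] by blast
  let ?Y = "\<lambda>t. {j \<in> J. verts (H j) \<inter> X t \<noteq> {}}"
  have "tree_decomposition ?K (with_proj T) ?Y"
    using td assms(4,5) by (rule tree_decomposition_touching_graph)
  \<comment> \<open>The tree is unchanged, so its nodes are still natural numbers and this value
    belongs to the set whose infimum defines \<open>tree_alpha ?K\<close>.\<close>
  then have "tree_alpha ?K \<le> decomposition_alpha ?K (with_proj T) ?Y"
    unfolding tree_alpha_def by (intro cInf_lower) auto
  also have "\<dots> \<le> decomposition_alpha G (with_proj T) X"
  proof -
    have "graph (with_proj T)" and "Digraph_Component.connected (with_proj T)"
      and bags: "\<And>t. t \<in> verts (with_proj T) \<Longrightarrow> X t \<subseteq> verts G"
      using td unfolding tree_decomposition_def undirected_tree_def by blast+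
    then have fin: "finite (verts (with_proj T))" and ne: "verts (with_proj T) \<noteq> {}"
      using fin_digraph.finite_verts[of "with_proj T"] digraph.axioms(1) graph.axioms(1)
        connected_conv[of "with_proj T"] by blast+
    \<comment> \<open>The comparison is made node by node; as both decompositions have the same
      finite nonempty node set, it passes to the maxima.\<close>
    have "independence_number (?K \<restriction> ?Y t) \<le> decomposition_alpha G (with_proj T) X"
      if "t \<in> verts (with_proj T)" for t
    proof -
      have "finite (X t)" using bags[OF that] finite_verts finite_subset by blast
      then have "independence_number (?K \<restriction> ?Y t) \<le> independence_number (G \<restriction> X t)"
        using assms(1,2) by (intro independence_number_touching_graph_le)
      also have "\<dots> \<le> decomposition_alpha G (with_proj T) X"
        unfolding decomposition_alpha_def using fin that by (intro Max_ge) auto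
      finally show ?thesis .
    qed
    then show ?thesis
      unfolding decomposition_alpha_def[of ?K] using fin ne by (subst Max_le_iff) auto
  qed
  finally show ?thesis using opt by simp
qed

end
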